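(* For all integers $d\ge 1$ and $n\ge d$, $$\min_{u_1,\dots,u_n\in S^{d-1}}\ \max_{\varepsilon\in\{-1,1\}^n}\left|\sum_{i=1}^n\varepsilon_i u_i\right|=\Theta\!\left(\frac{n}{\sqrt d}\right),$$ that is, there exist absolute constants $c,C>0$ such that for all integers $d\ge1$ and $n\ge d$ the left-hand side is at least $c\,n/\sqrt d$ and at most $C\,n/\sqrt d$.
   Context: $S^{d-1}$ is the Euclidean unit sphere in $\mathbb{R}^d$ and $|\cdot|$ is the Euclidean norm. The vectors $u_1,\dots,u_n$ need not be distinct. *)

theory Defs
  imports "HOL-Analysis.Analysis"
begin

text \<open>
  The dimension is quantified below the absolute constants, so vectors of dimension \<open>d\<close> are
  functions \<open>nat \<Rightarrow> real\<close> that vanish from index \<open>d\<close> on, as in the library's \<open>Euclidean_space d\<close>.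
  In this representation \<open>topspace (nsphere (d - 1))\<close> is the Euclidean unit sphere of
  \<open>d\<close>-dimensional space for \<open>d \<ge> 1\<close>; for \<open>d = 0\<close>, truncated subtraction makes it the
  sphere of dimension 0 instead.
\<close>

definition unit_systems :: "nat \<Rightarrow> nat \<Rightarrow> (nat \<Rightarrow> nat \<Rightarrow> real) set" where
  "unit_systems d n = {..<n} \<rightarrow>\<^sub>E topspace (nsphere (d - 1))"

definition sign_vectors :: "nat \<Rightarrow> (nat \<Rightarrow> real) set" where
  "sign_vectors n = {..<n} \<rightarrow>\<^sub>E {-1, 1}"

definition max_signed_sum :: "nat \<Rightarrow> nat \<Rightarrow> (nat \<Rightarrow> nat \<Rightarrow> real) \<Rightarrow> real" where
  "max_signed_sum d n u =
     Max ((\<lambda>\<epsilon>. L2_set (\<lambda>j. \<Sum>i<n. \<epsilon> i * u i j) {..<d}) ` sign_vectors n)"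

text \<open>The theorem states separately that this infimum is attained, i.e. that it is a minimum.\<close>

definition minmax_signed_sum :: "nat \<Rightarrow> nat \<Rightarrow> real" where
  "minmax_signed_sum d n = (INF u\<in>unit_systems d n. max_signed_sum d n u)"

end

theory Submission imports Defs begin

text \<open>
  The maximum over the signs equals the maximum over unit vectors \<open>v\<close> of \<open>\<Sum>i. \<bar>\<langle>u i, v\<rangle>\<bar>\<close>. For the
  lower bound, average this over the vectors \<open>v\<close> with all coordinates \<open>\<plusminus>1 / sqrt d\<close>: Khintchine's
  inequality, which follows from the second and fourth moments, shows that each \<open>\<bar>\<langle>u i, v\<rangle>\<bar>\<close> has
  mean at least a constant times \<open>1 / sqrt d\<close>. For the upper bound, repeat the standard basis
  cyclically: every coordinate of a signed sum is then at most \<open>n / d + 1\<close> in absolute value.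
  The minimum is attained because a finite product of spheres is compact.
\<close>

section \<open>Moments of signed sums and Khintchine's inequality\<close>

lemma sum_PiE_insert:
  assumes "x \<notin> A"
  shows "(\<Sum>s\<in>insert x A \<rightarrow>\<^sub>E B. f s) = (\<Sum>y\<in>B. \<Sum>s\<in>A \<rightarrow>\<^sub>E B. f (s(x := y)))"
  unfolding PiE_insert_eq using inj_combinator[OF assms, of "\<lambda>_. B"]
  by (subst sum.reindex) (simp_all add: sum.cartesian_product case_prod_unfold)

lemma sum_signs_insert:
  fixes f :: "('a \<Rightarrow> real) \<Rightarrow> real"
  assumes "x \<notin> A"
  shows "(\<Sum>s\<in>insert x A \<rightarrow>\<^sub>E {-1, 1}. f s) =
    (\<Sum>s\<in>A \<rightarrow>\<^sub>E {-1, 1}. f (s(x := -1)) + f (s(x := 1)))"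
  using assms by (simp add: sum_PiE_insert sum.distrib)

lemma signed_sum_fun_upd:
  fixes a s :: "'a \<Rightarrow> real"
  assumes "finite A" "x \<notin> A"
  shows "(\<Sum>i\<in>insert x A. (s(x := y)) i * a i) = y * a x + (\<Sum>i\<in>A. s i * a i)"
proof -
  have "(\<Sum>i\<in>A. (s(x := y)) i * a i) = (\<Sum>i\<in>A. s i * a i)"
    using assms by (intro sum.cong) auto
  then show ?thesis using assms by simp
qed

lemma card_signs: "finite A \<Longrightarrow> card (A \<rightarrow>\<^sub>E {-1, 1 :: real}) = 2 ^ card A"
  by (simp add: card_funcsetE numeral_2_eq_2)

text \<open>Independent signs are orthogonal: when a new element joins \<open>A\<close>, the cross
  terms for its two signs cancel, and each old term is counted twice.\<close>

lemma sum_signs_power2: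
  fixes a :: "'a \<Rightarrow> real"
  assumes "finite A"
  shows "(\<Sum>s\<in>A \<rightarrow>\<^sub>E {-1, 1}. (\<Sum>i\<in>A. s i * a i)\<^sup>2) = 2 ^ card A * (\<Sum>i\<in>A. (a i)\<^sup>2)"
  using assms
proof induction
  case (insert x A)
  have *: "(-1 * a x + t)\<^sup>2 + (1 * a x + t)\<^sup>2 = 2 * (a x)\<^sup>2 + 2 * t\<^sup>2" for t
    by (simp add: power2_eq_square algebra_simps)
  show ?case
    unfolding sum_signs_insert[OF insert.hyps(2)] signed_sum_fun_upd[OF insert.hyps] *
    using insert
    by (simp add: sum.distrib sum_distrib_left[symmetric] card_signs algebra_simps)
qed simp

text \<open>Adding the two values of the new sign cancels the odd powers and leaves the second
  moment, known exactly, and the fourth moment, bounded by induction. The factor 3 is the fourth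
  moment of a standard Gaussian.\<close>

lemma sum_signs_power4_le:
  fixes a :: "'a \<Rightarrow> real"
  assumes "finite A"
  shows "(\<Sum>s\<in>A \<rightarrow>\<^sub>E {-1, 1}. (\<Sum>i\<in>A. s i * a i) ^ 4) \<le> 3 * 2 ^ card A * (\<Sum>i\<in>A. (a i)\<^sup>2)\<^sup>2"
  using assms
proof induction
  case (insert x A)
  let ?S = "A \<rightarrow>\<^sub>E {-1, 1 :: real}" and ?t = "\<lambda>s. \<Sum>i\<in>A. s i * a i"
  let ?q = "\<Sum>i\<in>A. (a i)\<^sup>2" and ?N = "2 ^ card A :: real"
  have *: "(-1 * a x + t) ^ 4 + (1 * a x + t) ^ 4 = 2 * a x ^ 4 + 12 * (a x)\<^sup>2 * t\<^sup>2 + 2 * t ^ 4" for t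
    by algebra
  have "(\<Sum>s\<in>insert x A \<rightarrow>\<^sub>E {-1, 1}. (\<Sum>i\<in>insert x A. s i * a i) ^ 4) =
      2 * ?N * a x ^ 4 + 12 * (a x)\<^sup>2 * (\<Sum>s\<in>?S. (?t s)\<^sup>2) + 2 * (\<Sum>s\<in>?S. ?t s ^ 4)"
    unfolding sum_signs_insert[OF insert.hyps(2)] signed_sum_fun_upd[OF insert.hyps] *
    using insert.hyps by (simp add: sum.distrib sum_distrib_left[symmetric] card_signs)
  also have "\<dots> \<le> 2 * ?N * a x ^ 4 + 12 * (a x)\<^sup>2 * (?N * ?q) + 2 * (3 * ?N * ?q\<^sup>2)"
    using insert by (simp add: sum_signs_power2)
  also have "\<dots> = 2 * ?N * (a x ^ 4 + 6 * (a x)\<^sup>2 * ?q + 3 * ?q\<^sup>2)"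
    by algebra
  also have "\<dots> \<le> 2 * ?N * (3 * ((a x)\<^sup>2 + ?q)\<^sup>2)"
  proof (rule mult_left_mono)
    have "a x ^ 4 \<ge> 0"
      by simp
    \<comment> \<open>The mixed terms agree exactly; the only loss is in the coefficient of
      \<open>a x ^ 4\<close>, raised from 1 to 3.\<close>
    moreover have "3 * ((a x)\<^sup>2 + ?q)\<^sup>2 = (a x ^ 4 + 6 * (a x)\<^sup>2 * ?q + 3 * ?q\<^sup>2) + 2 * a x ^ 4"
      by algebra
    ultimately show "a x ^ 4 + 6 * (a x)\<^sup>2 * ?q + 3 * ?q\<^sup>2 \<le> 3 * ((a x)\<^sup>2 + ?q)\<^sup>2"
      by linarith
  qed simp
  also have "\<dots> = 3 * 2 ^ card (insert x A) * (\<Sum>i\<in>insert x A. (a i)\<^sup>2)\<^sup>2"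
    using insert.hyps by simp
  finally show ?case .
qed simp

text \<open>The minorant is even and tangent to the absolute value at \<open>\<plusminus>2\<close>.\<close>
lemma abs_ge_quartic: "3 / 4 * t\<^sup>2 - t ^ 4 / 16 \<le> \<bar>t\<bar>" for t :: real
proof -
  \<comment> \<open>The double root at 2 gives the tangency, and the cofactor
    \<open>\<bar>t\<bar> + 4\<close> removes the cubic term, so that only second and fourth moments
    are needed later.\<close>
  have "0 \<le> \<bar>t\<bar> * (\<bar>t\<bar> - 2)\<^sup>2 * (\<bar>t\<bar> + 4)"
    by simp
  also have "\<dots> = 16 * \<bar>t\<bar> - 12 * \<bar>t\<bar>\<^sup>2 + \<bar>t\<bar> ^ 4"
    by algebra
  finally show ?thesis
    by simp
qed

text \<open>Average the quartic minorant of the absolute value: the second moment is 1 and the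
  fourth at most 3, which gives 3/4 - 3/16 = 9/16. Tangency at sqrt 3 would give the best constant
  of this method, 1 / sqrt 3; tangency at 2 keeps the numbers rational at little cost.\<close>

lemma Khintchine_L1:
  fixes a :: "'a \<Rightarrow> real"
  assumes "finite A" and unit: "(\<Sum>i\<in>A. (a i)\<^sup>2) = 1"
  shows "9 / 16 * 2 ^ card A \<le> (\<Sum>s\<in>A \<rightarrow>\<^sub>E {-1, 1}. \<bar>\<Sum>i\<in>A. s i * a i\<bar>)"
proof -
  let ?S = "A \<rightarrow>\<^sub>E {-1, 1 :: real}" and ?t = "\<lambda>s. \<Sum>i\<in>A. s i * a i"
  have "9 / 16 * 2 ^ card A \<le> 3 / 4 * (\<Sum>s\<in>?S. (?t s)\<^sup>2) - (\<Sum>s\<in>?S. ?t s ^ 4) / 16"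
    using sum_signs_power2[OF assms(1), of a] sum_signs_power4_le[OF assms(1), of a]
    by (simp add: unit)
  also have "\<dots> = (\<Sum>s\<in>?S. 3 / 4 * (?t s)\<^sup>2 - ?t s ^ 4 / 16)"
    by (simp add: sum_subtractf sum_distrib_left sum_divide_distrib)
  also have "\<dots> \<le> (\<Sum>s\<in>?S. \<bar>?t s\<bar>)"
    by (intro sum_mono abs_ge_quartic)
  finally show ?thesis .
qed

section \<open>Duality between signs and test vectors, and the lower bound\<close>

lemma mem_topspace_nsphere_pred:
  assumes "d \<ge> 1"
  \<comment> \<open>\<open>Suc 0\<close> instead of 1 is the simplifier's normal form, so this works
    as a rewrite rule.\<close>
  shows "x \<in> topspace (nsphere (d - Suc 0)) \<longleftrightarrow> (\<Sum>j<d. (x j)\<^sup>2) = 1 \<and> (\<forall>j\<ge>d. x j = 0)"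
proof -
  have "{..d - Suc 0} = {..<d}" "d - Suc 0 < j \<longleftrightarrow> d \<le> j" for j
    using assms by auto
  then show ?thesis
    by (auto simp: nsphere)
qed

lemma finite_sign_vectors: "finite (sign_vectors n)"
  unfolding sign_vectors_def by (intro finite_PiE) auto

lemma sign_vectors_nonempty: "sign_vectors n \<noteq> {}"
  unfolding sign_vectors_def by (simp add: PiE_eq_empty_iff)

lemma le_max_signed_sum:
  assumes "\<epsilon> \<in> sign_vectors n"
  shows "L2_set (\<lambda>j. \<Sum>i<n. \<epsilon> i * u i j) {..<d} \<le> max_signed_sum d n u"
  unfolding max_signed_sum_def using assms finite_sign_vectors by (intro Max_ge) auto

lemma max_signed_sum_le_iff:
  "max_signed_sum d n u \<le> b \<longleftrightarrow>
    (\<forall>\<epsilon>\<in>sign_vectors n. L2_set (\<lambda>j. \<Sum>i<n. \<epsilon> i * u i j) {..<d} \<le> b)"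
  unfolding max_signed_sum_def
  using finite_sign_vectors sign_vectors_nonempty by (subst Max_le_iff) auto

text \<open>Give each vector the sign of its inner product with \<open>v\<close>. The left side is
  then the inner product of \<open>v\<close> with a single signed sum, and the Cauchy-Schwarz
  inequality applies.\<close>

lemma sum_abs_inner_le_max_signed_sum:
  "(\<Sum>i<n. \<bar>\<Sum>j<d. v j * u i j\<bar>) \<le> L2_set v {..<d} * max_signed_sum d n u"
proof -
  define \<epsilon> :: "nat \<Rightarrow> real"
    where "\<epsilon> = (\<lambda>i\<in>{..<n}. if (\<Sum>j<d. v j * u i j) < 0 then -1 else 1)"
  have \<epsilon>: "\<epsilon> \<in> sign_vectors n"
    by (auto simp: \<epsilon>_def sign_vectors_def)
  have "(\<Sum>i<n. \<bar>\<Sum>j<d. v j * u i j\<bar>) = (\<Sum>i<n. \<epsilon> i * (\<Sum>j<d. v j * u i j))"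
    by (intro sum.cong) (auto simp: \<epsilon>_def)
  also have "\<dots> = (\<Sum>i<n. \<Sum>j<d. v j * (\<epsilon> i * u i j))"
    by (simp add: sum_distrib_left mult.left_commute)
  also have "\<dots> = (\<Sum>j<d. v j * (\<Sum>i<n. \<epsilon> i * u i j))"
    by (subst sum.swap) (simp add: sum_distrib_left)
  also have "\<dots> \<le> (\<Sum>j<d. \<bar>v j\<bar> * \<bar>\<Sum>i<n. \<epsilon> i * u i j\<bar>)"
    by (intro sum_mono) (metis abs_ge_self abs_mult)
  also have "\<dots> \<le> L2_set v {..<d} * L2_set (\<lambda>j. \<Sum>i<n. \<epsilon> i * u i j) {..<d}"
    by (rule L2_set_mult_ineq)
  also have "\<dots> \<le> L2_set v {..<d} * max_signed_sum d n u"
    using le_max_signed_sum[OF \<epsilon>] by (intro mult_left_mono) auto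
  finally show ?thesis .
qed

text \<open>Here the random signs \<open>s\<close> are the coordinates of the test vector, and
  Khintchine's inequality is applied to the coordinates of each \<open>u i\<close>. The test vectors
  are not normalised: their norm \<open>sqrt d\<close> supplies the denominator.\<close>

lemma max_signed_sum_ge:
  assumes "d \<ge> 1" and u: "u \<in> unit_systems d n"
  shows "9 / 16 * (real n / sqrt (real d)) \<le> max_signed_sum d n u"
proof -
  let ?S = "{..<d} \<rightarrow>\<^sub>E {-1, 1 :: real}"
  have "9 / 16 * 2 ^ d \<le> (\<Sum>s\<in>?S. \<bar>\<Sum>j<d. s j * u i j\<bar>)" if "i < n" for i
  proof -
    have "(\<Sum>j<d. (u i j)\<^sup>2) = 1"
      using u that mem_topspace_nsphere_pred[OF assms(1)] by (auto simp: unit_systems_def)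
    then show ?thesis
      using Khintchine_L1[of "{..<d}" "u i"] by simp
  qed
  then have "(\<Sum>i<n. 9 / 16 * 2 ^ d) \<le> (\<Sum>i<n. \<Sum>s\<in>?S. \<bar>\<Sum>j<d. s j * u i j\<bar>)"
    by (intro sum_mono) auto
  also have "\<dots> = (\<Sum>s\<in>?S. \<Sum>i<n. \<bar>\<Sum>j<d. s j * u i j\<bar>)"
    by (rule sum.swap)
  also have "\<dots> \<le> (\<Sum>s\<in>?S. sqrt d * max_signed_sum d n u)"
  proof (rule sum_mono)
    fix s assume "s \<in> ?S"
    then have "(s j)\<^sup>2 = 1" if "j < d" for j
      using that by (auto simp: PiE_iff power2_eq_1_iff)
    then have "L2_set s {..<d} = sqrt d"
      by (simp add: L2_set_def)
    then show "(\<Sum>i<n. \<bar>\<Sum>j<d. s j * u i j\<bar>) \<le> sqrt d * max_signed_sum d n u"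
      using sum_abs_inner_le_max_signed_sum[where v = s] by metis
  qed
  also have "\<dots> = 2 ^ d * (sqrt d * max_signed_sum d n u)"
    by (simp add: card_signs)
  finally have "2 ^ d * (9 / 16 * real n) \<le> 2 ^ d * (sqrt d * max_signed_sum d n u)"
    by (simp add: algebra_simps)
  then have "9 / 16 * real n \<le> sqrt d * max_signed_sum d n u"
    by (rule mult_left_le_imp_le) simp
  then show ?thesis
    using assms(1) by (simp add: field_simps)
qed

section \<open>The upper bound from a cyclically repeated basis\<close>

lemma card_residue_class_le: "card {i. i < n \<and> i mod d = j} \<le> n div d + 1" for n d j :: nat
proof -
  \<comment> \<open>Within a residue class, \<open>i\<close> is determined by its quotient. The
    endpoint \<open>n div d\<close> is included because the last block may be incomplete.\<close>
  have "{i. i < n \<and> i mod d = j} \<subseteq> (\<lambda>q. q * d + j) ` {..n div d}"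
  proof
    fix i assume "i \<in> {i. i < n \<and> i mod d = j}"
    then have "i = i div d * d + j" "i div d \<le> n div d"
      by (auto intro: div_le_mono)
    then show "i \<in> (\<lambda>q. q * d + j) ` {..n div d}"
      by blast
  qed
  then have "card {i. i < n \<and> i mod d = j} \<le> card {..n div d}"
    by (rule surj_card_le[rotated]) simp
  then show ?thesis
    by simp
qed

definition cyclic_basis :: "nat \<Rightarrow> nat \<Rightarrow> nat \<Rightarrow> nat \<Rightarrow> real" where
  "cyclic_basis d n = (\<lambda>i\<in>{..<n}. \<lambda>j. if j = i mod d then 1 else 0)"

lemma cyclic_basis_mem_unit_systems:
  assumes "d \<ge> 1"
  shows "cyclic_basis d n \<in> unit_systems d n"
proof -
  have "(\<lambda>j. if j = i mod d then 1 else 0) \<in> topspace (nsphere (d - 1))" for i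
    using assms by (auto simp: mem_topspace_nsphere_pred if_distrib[of "\<lambda>x. x\<^sup>2"] not_le cong: if_cong)
  then show ?thesis
    by (auto simp: cyclic_basis_def unit_systems_def)
qed

lemma max_signed_sum_cyclic_basis_le:
  assumes "d \<ge> 1" "n \<ge> d"
  shows "max_signed_sum d n (cyclic_basis d n) \<le> 2 * (real n / sqrt (real d))"
  unfolding max_signed_sum_le_iff
proof
  fix \<epsilon> assume \<epsilon>: "\<epsilon> \<in> sign_vectors n"
  let ?m = "2 * (real n / real d)"
  have coord: "\<bar>\<Sum>i<n. \<epsilon> i * cyclic_basis d n i j\<bar> \<le> ?m" for j
  proof -
    have abs_\<epsilon>: "\<bar>\<epsilon> i\<bar> = 1" if "i < n" for i
      using \<epsilon> that by (auto simp: sign_vectors_def PiE_iff abs_eq_iff')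
    have "\<bar>\<Sum>i<n. \<epsilon> i * cyclic_basis d n i j\<bar> \<le> (\<Sum>i<n. \<bar>\<epsilon> i * cyclic_basis d n i j\<bar>)"
      by (rule sum_abs)
    also have "\<dots> = (\<Sum>i<n. if i mod d = j then 1 else 0)"
      by (intro sum.cong) (auto simp: cyclic_basis_def abs_mult abs_\<epsilon>)
    also have "\<dots> = real (card {i. i < n \<and> i mod d = j})"
      by (simp add: sum.If_cases Int_def)
    also have "\<dots> \<le> real (n div d) + 1"
      using card_residue_class_le[of n d j] by linarith
    also have "\<dots> \<le> real n / real d + 1"
      using of_nat_div_le_of_nat[of n d] by simp
    \<comment> \<open>Here \<open>n \<ge> d\<close> enters: it gives 1 \<le> n / d, which absorbs
      the rounding term and produces the factor 2.\<close>
    also have "\<dots> \<le> ?m"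
      using assms by (simp add: field_simps)
    finally show ?thesis .
  qed
  have "L2_set (\<lambda>j. \<Sum>i<n. \<epsilon> i * cyclic_basis d n i j) {..<d}
      = L2_set (\<lambda>j. \<bar>\<Sum>i<n. \<epsilon> i * cyclic_basis d n i j\<bar>) {..<d}"
    by (simp add: L2_set_def)
  \<comment> \<open>With \<open>d\<close> coordinates of size at most \<open>?m\<close>, the norm is
    at most \<open>sqrt d * ?m\<close>.\<close>
  also have "\<dots> \<le> L2_set (\<lambda>j. ?m) {..<d}"
    by (rule L2_set_mono) (use coord in auto)
  also have "\<dots> = 2 * (real n / sqrt (real d))"
    using assms by (simp add: L2_set_constant field_simps)
  finally show "L2_set (\<lambda>j. \<Sum>i<n. \<epsilon> i * cyclic_basis d n i j) {..<d} \<le> 2 * (real n / sqrt (real d))" .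
qed

section \<open>Compactness, continuity and attainment of the minimum\<close>

lemma continuous_on_Max_image:
  fixes f :: "'i \<Rightarrow> 'a::topological_space \<Rightarrow> 'b::linorder_topology"
  assumes "finite I" "I \<noteq> {}" "\<And>i. i \<in> I \<Longrightarrow> continuous_on S (f i)"
  shows "continuous_on S (\<lambda>x. Max ((\<lambda>i. f i x) ` I))"
  using assms
proof (induction rule: finite_ne_induct)
  case (insert i I)
  then show ?case
    by (simp add: continuous_on_max)
qed simp

text \<open>Tychonoff's theorem, transferred to the topology that the type class puts on functions:
  this is the product topology over \<open>UNIV\<close>.\<close>

lemma compact_PiE_UNIV:
  fixes S :: "'i \<Rightarrow> 'a::topological_space set"
  assumes "\<And>i. compact (S i)"
  shows "compact (Pi UNIV S)"
proof -
  have "compactin (product_topology (\<lambda>i. euclidean) UNIV) (PiE UNIV S)"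
    unfolding compactin_PiE using assms by simp
  then show ?thesis
    by (simp add: euclidean_product_topology PiE_UNIV_domain)
qed

lemma continuous_on_coordinate2: "continuous_on S (\<lambda>u. u i j :: 'a::topological_space)"
  by (rule continuous_on_product_then_coordinatewise[OF continuous_on_product_then_coordinatewise[OF continuous_on_id]])

text \<open>Although the ambient space has infinitely many coordinates, all those from
  \<open>d\<close> on are confined to the compact singleton of 0. The sphere is thus a closed level
  set inside a product of compact sets.\<close>

lemma compact_nsphere:
  assumes "d \<ge> 1"
  shows "compact (topspace (nsphere (d - 1)))"
proof -
  let ?box = "\<Pi> j\<in>UNIV. if j < d then {-1..1} else {0 :: real}"
  let ?level = "{x. (\<Sum>j<d. (x j)\<^sup>2) = (1 :: real)}"
  have "topspace (nsphere (d - 1)) = ?box \<inter> ?level"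
  proof (intro equalityI subsetI)
    fix x assume x: "x \<in> topspace (nsphere (d - 1))"
    have "\<bar>x j\<bar> \<le> 1" if "j < d" for j
    proof -
      have "(x j)\<^sup>2 \<le> (\<Sum>j<d. (x j)\<^sup>2)"
        by (rule member_le_sum) (use that in auto)
      then show ?thesis
        using x assms by (simp add: mem_topspace_nsphere_pred abs_square_le_1)
    qed
    then show "x \<in> ?box \<inter> ?level"
      using x assms by (auto simp: mem_topspace_nsphere_pred abs_le_iff minus_le_iff)
  next
    fix x assume x: "x \<in> ?box \<inter> ?level"
    have "x j = 0" if "j \<ge> d" for j
    proof -
      have "x j \<in> (if j < d then {-1..1} else {0})"
        using x by blast
      then show ?thesis
        using that by simp
    qed
    then show "x \<in> topspace (nsphere (d - 1))"
      using assms x by (simp add: mem_topspace_nsphere_pred)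
  qed
  moreover have "compact ?box"
    by (rule compact_PiE_UNIV) simp
  moreover have "closed ?level"
    by (intro closed_Collect_eq continuous_on_sum continuous_on_power continuous_on_const
        continuous_on_product_coordinates)
  ultimately show ?thesis
    by (simp add: compact_Int_closed)
qed

lemma compact_unit_systems:
  assumes "d \<ge> 1"
  shows "compact (unit_systems d n)"
proof -
  \<comment> \<open>Extensionality fixes the value \<open>undefined\<close> at every index from
    \<open>n\<close> on, which turns the restricted product into a product over \<open>UNIV\<close>
    with compact singleton factors.\<close>
  have "unit_systems d n = (\<Pi> i\<in>UNIV. if i < n then topspace (nsphere (d - 1)) else {undefined})"
    unfolding unit_systems_def PiE_def extensional_def Pi_def
    by (intro set_eqI) (simp, metis)
  moreover have "compact \<dots>"
    using compact_nsphere[OF assms] by (intro compact_PiE_UNIV) simp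
  ultimately show ?thesis
    by simp
qed

lemma continuous_on_max_signed_sum: "continuous_on S (max_signed_sum d n)"
  unfolding max_signed_sum_def L2_set_def
  by (intro continuous_on_Max_image finite_sign_vectors sign_vectors_nonempty
      continuous_on_real_sqrt continuous_on_sum continuous_on_power continuous_on_mult_left
      continuous_on_coordinate2)

text \<open>A continuous function on a nonempty compact set attains its infimum. The cyclic basis
  witnesses nonemptiness, and the minimiser itself bounds the values below, so the infimum is well
  behaved.\<close>

lemma max_signed_sum_attains_minmax:
  assumes "d \<ge> 1"
  obtains u where "u \<in> unit_systems d n" "max_signed_sum d n u = minmax_signed_sum d n"
    "\<And>w. w \<in> unit_systems d n \<Longrightarrow> minmax_signed_sum d n \<le> max_signed_sum d n w"
proof -
  have "unit_systems d n \<noteq> {}"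
    using cyclic_basis_mem_unit_systems[OF assms] by blast
  then obtain u where u: "u \<in> unit_systems d n"
    and le: "\<And>w. w \<in> unit_systems d n \<Longrightarrow> max_signed_sum d n u \<le> max_signed_sum d n w"
    using continuous_attains_inf[OF compact_unit_systems[OF assms] _ continuous_on_max_signed_sum]
    by metis
  moreover have "minmax_signed_sum d n = max_signed_sum d n u"
    unfolding minmax_signed_sum_def by (rule cInf_eq_minimum) (use u le in auto)
  ultimately show ?thesis
    using that by simp
qed

theorem theorem4:
  "\<exists>c C :: real. c > 0 \<and> C > 0 \<and>
     (\<forall>d n :: nat. d \<ge> 1 \<longrightarrow> n \<ge> d \<longrightarrow>
        (\<exists>u\<in>unit_systems d n. max_signed_sum d n u = minmax_signed_sum d n) \<and>
        c * (real n / sqrt (real d)) \<le> minmax_signed_sum d n \<and>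
        minmax_signed_sum d n \<le> C * (real n / sqrt (real d)))"
proof (rule exI[of _ "9 / 16"], rule exI[of _ 2], intro conjI allI impI)
  fix d n :: nat
  assume d: "d \<ge> 1" and n: "n \<ge> d"
  obtain u where u: "u \<in> unit_systems d n" "max_signed_sum d n u = minmax_signed_sum d n"
    and le: "\<And>w. w \<in> unit_systems d n \<Longrightarrow> minmax_signed_sum d n \<le> max_signed_sum d n w"
    using max_signed_sum_attains_minmax[OF d] by blast
  show "\<exists>u\<in>unit_systems d n. max_signed_sum d n u = minmax_signed_sum d n"
    using u by blast
  show "9 / 16 * (real n / sqrt (real d)) \<le> minmax_signed_sum d n"
    using max_signed_sum_ge[OF d u(1)] u(2) by simp
  show "minmax_signed_sum d n \<le> 2 * (real n / sqrt (real d))"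
    using le[OF cyclic_basis_mem_unit_systems[OF d]] max_signed_sum_cyclic_basis_le[OF d n]
    by (rule order_trans)
qed simp_all

end
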